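(* If $H$ is a quasi-symmetric sparse semigroup, then either $H=\langle 3,4,5\rangle$ or $H=\langle 3,5,7\rangle$.
   Context: $\mathbb{N}$ is the set of natural numbers including $0$. A numerical semigroup $H\subseteq\mathbb{N}$ of genus $g\ge 1$ is a subset containing $0$, closed under addition, whose complement $\mathbb{N}\setminus H=\{1=\ell_1<\ell_2<\dots<\ell_g\}$ has exactly $g$ elements, called gaps; $\ell_g$ is the Frobenius number. $H$ is sparse if $\ell_i-\ell_{i-1}\le 2$ for all $i=2,\dots,g$, and quasi-symmetric if $\ell_g=2g-2$. $\langle A\rangle$ is the additive submonoid of $\mathbb{N}$ generated by $A$. *)

theory Defs
  imports Main "HOL.Hull"
begin

definition additive_submonoid :: "nat set \<Rightarrow> bool" where
  "additive_submonoid S \<longleftrightarrow> 0 \<in> S \<and> (\<forall>x\<in>S. \<forall>y\<in>S. x + y \<in> S)"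

text \<open>The hull is the intersection of all additive submonoids of \<open>nat\<close> that contain \<open>A\<close>.\<close>

definition generated_submonoid :: "nat set \<Rightarrow> nat set" where
  "generated_submonoid A = additive_submonoid hull A"

definition gaps :: "nat set \<Rightarrow> nat set" where
  "gaps H = UNIV - H"

definition numerical_semigroup :: "nat set \<Rightarrow> bool" where
  "numerical_semigroup H \<longleftrightarrow> additive_submonoid H \<and> finite (gaps H)"

definition genus :: "nat set \<Rightarrow> nat" where
  "genus H = card (gaps H)"

text \<open>\<open>gap H i\<close> is the \<open>i\<close>-th smallest gap; indices run from \<open>1\<close> to \<open>genus H\<close>, and
  the value is meaningless outside this range.\<close>

definition gap :: "nat set \<Rightarrow> nat \<Rightarrow> nat" where
  "gap H i = sorted_list_of_set (gaps H) ! (i - 1)"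

definition frobenius_number :: "nat set \<Rightarrow> nat" where
  "frobenius_number H = gap H (genus H)"

text \<open>Differences are taken in \<open>int\<close> to avoid truncated subtraction.\<close>

definition sparse :: "nat set \<Rightarrow> bool" where
  "sparse H \<longleftrightarrow> (\<forall>i\<in>{2..genus H}. int (gap H i) - int (gap H (i - 1)) \<le> 2)"

definition quasi_symmetric :: "nat set \<Rightarrow> bool" where
  "quasi_symmetric H \<longleftrightarrow> int (frobenius_number H) = 2 * int (genus H) - 2"

end

theory Submission
  imports Defs
begin

text \<open>
  As $F = 2g - 2$ is a positive even gap, neither 1 nor 2 lies in $H$. Hence the gaps start with
  $\ell_1 = 1$ and $\ell_2 = 2$. The remaining $g - 2$ steps have length at most 2 and add up to
  $2g - 4$, so each of them equals 2 and the gaps are $1, 2, 4, 6, \dots, 2g - 2$. For $g \ge 4$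
  the element 3 would lie in $H$ but $6 = 3 + 3$ would not. So the gaps are $1, 2$ or $1, 2, 4$.
\<close>

lemma additive_submonoid_mult_add:
  assumes "additive_submonoid S" "a \<in> S" "r \<in> S"
  shows "k * a + r \<in> S"
  using assms by (induction k) (auto simp: additive_submonoid_def add.assoc)

lemma generated_submonoid_eqI:
  assumes "A \<subseteq> S" "additive_submonoid S"
    and "\<And>T. A \<subseteq> T \<Longrightarrow> additive_submonoid T \<Longrightarrow> S \<subseteq> T"
  shows "generated_submonoid A = S"
  unfolding generated_submonoid_def using assms by (rule hull_unique)

text \<open>Three consecutive numbers meet every residue class modulo 3, and adding 3 moves upwards
  within a class.\<close>

lemma mem_submonoid_if_three_consecutive:
  assumes T: "additive_submonoid T" "3 \<in> T"
    and m: "m \<in> T" "m + 1 \<in> T" "m + 2 \<in> T" "m \<le> n"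
  shows "n \<in> T"
  using m(4)
proof (induction n rule: less_induct)
  case (less n)
  then consider "n = m" | "n = m + 1" | "n = m + 2" | "m \<le> n - 3" "3 \<le> n"
    by linarith
  then show ?case
  proof cases
    case 4
    then have "n - 3 \<in> T"
      by (intro less.IH) simp_all
    then have "n - 3 + 3 \<in> T"
      using T unfolding additive_submonoid_def by blast
    with 4 show ?thesis
      by simp
  qed (use m in simp_all)
qed

lemma generated_submonoid_3_4_5: "generated_submonoid {3, 4, 5} = {0} \<union> {3..}"
proof (rule generated_submonoid_eqI)
  fix T assume T: "{3, 4, 5} \<subseteq> T" "additive_submonoid T"
  then have "n \<in> T" if "3 \<le> n" for n
    using mem_submonoid_if_three_consecutive[of T 3 n] that by simp
  with T(2) show "{0} \<union> {3..} \<subseteq> T"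
    by (auto simp: additive_submonoid_def)
qed (auto simp: additive_submonoid_def)

lemma generated_submonoid_3_5_7: "generated_submonoid {3, 5, 7} = {0, 3} \<union> {5..}"
proof (rule generated_submonoid_eqI)
  fix T assume T: "{3, 5, 7} \<subseteq> T" "additive_submonoid T"
  \<comment> \<open>The sum 3 + 3 fills the hole between 5 and 7, giving three consecutive
    elements.\<close>
  then have "6 \<in> T"
    using additive_submonoid_mult_add[of T 3 3 1] by simp
  then have "n \<in> T" if "5 \<le> n" for n
    using mem_submonoid_if_three_consecutive[of T 5 n] T that by simp
  with T show "{0, 3} \<union> {5..} \<subseteq> T"
    by (auto simp: additive_submonoid_def)
qed (auto simp: additive_submonoid_def)

lemma gap_strict_mono:
  assumes "1 \<le> i" "i < j" "j \<le> genus H"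
  shows "gap H i < gap H j"
  using assms sorted_wrt_nth_less[OF strict_sorted_list_of_set[of "gaps H"], of "i - 1" "j - 1"]
  by (simp add: gap_def genus_def)

lemma gap_image:
  assumes "finite (gaps H)"
  shows "gap H ` {1..genus H} = gaps H"
proof -
  have "gap H ` {1..genus H} = (!) (sorted_list_of_set (gaps H)) ` (\<lambda>i. i - 1) ` {1..genus H}"
    by (auto simp: gap_def image_image)
  also have "(\<lambda>i. i - 1) ` {1..genus H} = {..<genus H}"
    by (force simp: image_iff intro: bexI[of _ "Suc _"])
  finally show ?thesis
    using assms nth_image[of "genus H" "sorted_list_of_set (gaps H)"]
    by (simp add: genus_def lessThan_atLeast0)
qed

text \<open>The first gap is positive because 0 lies in \<open>H\<close>, and each later gap is
  larger by at least 1. Read backwards, this bounds the index of a gap by its value.\<close>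

lemma le_gap:
  assumes "0 \<in> H" "finite (gaps H)" "1 \<le> i" "i \<le> genus H"
  shows "i \<le> gap H i"
  using assms(3,4)
proof (induction i rule: dec_induct)
  case base
  then have "gap H 1 \<in> gaps H"
    using gap_image[OF assms(2)] by fastforce
  then show ?case
    using assms(1) by (cases "gap H 1") (auto simp: gaps_def)
next
  case (step n)
  then show ?case
    using gap_strict_mono[of n "Suc n" H] by simp
qed

lemma gap_1_2:
  assumes "0 \<in> H" "finite (gaps H)" "1 \<in> gaps H" "2 \<in> gaps H"
  shows "2 \<le> genus H" "gap H 1 = 1" "gap H 2 = 2"
proof -
  obtain i j where ij: "i \<in> {1..genus H}" "gap H i = 1" "j \<in> {1..genus H}" "gap H j = 2"
    using assms(3,4) unfolding gap_image[OF assms(2), symmetric] by (auto simp: image_iff)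
  have "i \<le> 1" "j \<le> 2"
    using le_gap[OF assms(1,2), of i] le_gap[OF assms(1,2), of j] ij by simp_all
  moreover have "i \<noteq> j"
    using ij by auto
  ultimately have "i = 1" "j = 2"
    using ij by auto
  then show "2 \<le> genus H" "gap H 1 = 1" "gap H 2 = 2"
    using ij by auto
qed

text \<open>Telescoping the sparseness bound. Applied below an index it bounds that gap from above,
  applied beyond it from below.\<close>

lemma sparse_gap_le:
  assumes "sparse H" "1 \<le> i" "i \<le> j" "j \<le> genus H"
  shows "gap H j \<le> gap H i + 2 * (j - i)"
  using assms(3,4)
proof (induction j rule: dec_induct)
  case (step n)
  then have "gap H (Suc n) \<le> gap H n + 2"
    using assms(1,2) by (auto simp: sparse_def dest: bspec[of _ _ "Suc n"])
  then show ?case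
    using step by simp
qed simp

theorem corollary2p5:
  fixes H :: "nat set"
  assumes "numerical_semigroup H"
    and "genus H \<ge> 1"
    and "quasi_symmetric H"
    and "sparse H"
  shows "H = generated_submonoid {3, 4, 5} \<or> H = generated_submonoid {3, 5, 7}"
proof -
  have sub: "additive_submonoid H" and fin: "finite (gaps H)"
    using assms(1) by (auto simp: numerical_semigroup_def)
  then have zero: "0 \<in> H"
    by (simp add: additive_submonoid_def)
  have last: "gap H (genus H) = 2 * (genus H - 1)"
    using assms(2,3) by (simp add: quasi_symmetric_def frobenius_number_def)
  have "gap H (genus H) \<in> gaps H"
    using gap_image[OF fin] assms(2) by fastforce
  \<comment> \<open>The Frobenius number is written as a multiple of 2 plus 0, so that 2 in
    \<open>H\<close> would force it into \<open>H\<close>.\<close>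
  then have "(genus H - 1) * 2 + 0 \<notin> H"
    by (simp add: last gaps_def mult.commute)
  then have two: "2 \<in> gaps H"
    using additive_submonoid_mult_add[OF sub _ zero] by (auto simp: gaps_def)
  then have "1 \<in> gaps H"
    using additive_submonoid_mult_add[OF sub _ zero, of 1 2] by (auto simp: gaps_def)
  note init = gap_1_2[OF zero fin this two]
  \<comment> \<open>Going up from \<open>gap H 2 = 2\<close> gives \<le>; going up from
    \<open>i\<close> to the last gap, whose value is known, gives \<ge>.\<close>
  have gap: "gap H i = 2 * (i - 1)" if "2 \<le> i" "i \<le> genus H" for i
    using sparse_gap_le[OF assms(4), of 2 i] sparse_gap_le[OF assms(4), of i "genus H"]
      that init last by simp
  \<comment> \<open>Index 1 is split off because the formula would give 0 there instead of
    1.\<close>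
  have "gaps H = gap H ` insert 1 {2..genus H}"
    using gap_image[OF fin] init(1) by (simp add: atLeastAtMost_insertL numeral_2_eq_2)
  also have "\<dots> = insert 1 ((\<lambda>i. 2 * (i - 1)) ` {2..genus H})"
    using init(2) gap image_cong[of "{2..genus H}" _ "gap H" "\<lambda>i. 2 * (i - 1)"] by simp
  finally have gaps: "gaps H = insert 1 ((\<lambda>i. 2 * (i - 1)) ` {2..genus H})" .
  have H: "H = - gaps H"
    by (auto simp: gaps_def)
  \<comment> \<open>All gaps other than 1 are even.\<close>
  have "3 \<in> H"
  proof (rule ccontr)
    assume "3 \<notin> H"
    then have "3 \<in> gaps H"
      by (simp add: gaps_def)
    then obtain i :: nat where "3 = 2 * (i - 1)"
      unfolding gaps by auto
    then show False
      by presburger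
  qed
  then have "6 \<in> H"
    using additive_submonoid_mult_add[OF sub _ zero, of 3 2] by simp
  have "genus H < 4"
  proof (rule ccontr)
    assume "\<not> genus H < 4"
    \<comment> \<open>The witness is index 4, as 6 = 2 * (4 - 1).\<close>
    then have "6 \<in> gaps H"
      unfolding gaps by (auto simp: image_iff intro: bexI[of _ 4])
    with \<open>6 \<in> H\<close> show False
      by (simp add: gaps_def)
  qed
  with init(1) consider "genus H = 2" | "genus H = 3"
    by linarith
  then show ?thesis
  proof cases
    case 1
    then have *: "gaps H = {1, 2}"
      using gaps by simp
    have "- gaps H = {0} \<union> {3..}"
      unfolding * by (intro set_eqI) auto
    then have "H = generated_submonoid {3, 4, 5}"
      unfolding generated_submonoid_3_4_5 by (rule trans[OF H])
    then show ?thesis ..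
  next
    case 2
    moreover have "{2..3} = {2, 3::nat}"
      by auto
    ultimately have *: "gaps H = {1, 2, 4}"
      using gaps by simp
    have "- gaps H = {0, 3} \<union> {5..}"
      unfolding * by (intro set_eqI) auto
    then have "H = generated_submonoid {3, 5, 7}"
      unfolding generated_submonoid_3_5_7 by (rule trans[OF H])
    then show ?thesis ..
  qed
qed

end
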